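(* Let $r\geq 3$ be an integer and let $G$ be a finite simple $K_{1,r}$-free graph. If $\delta(G)\geq \left\lfloor\frac{r}{2}\right\rfloor+1$, then $G$ is a $\mathcal{P}_{\geq 2}$-factor covered graph, i.e., for every edge $e\in E(G)$ there is a $\mathcal{P}_{\geq 2}$-factor of $G$ containing $e$.
   Context: All graphs are finite and simple. $\delta(G)$ is the minimum degree of $G$. $K_{1,r}$ denotes the star with one center vertex adjacent to $r$ leaves; $G$ is $K_{1,r}$-free if it contains no induced subgraph isomorphic to $K_{1,r}$. For an integer $k\geq 2$, a $\mathcal{P}_{\geq k}$-factor of $G$ is a spanning subgraph of $G$ every connected component of which is a path with at least $k$ vertices. $G$ is a $\mathcal{P}_{\geq k}$-factor covered graph if for every $e\in E(G)$ there is a $\mathcal{P}_{\geq k}$-factor of $G$ whose edge set contains $e$. *)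

theory Defs
  imports "Graph_Theory.Graph_Theory"
begin

text \<open>
  Finite simple undirected graphs are the instances of \<^locale>\<open>graph\<close>: finite, loop-free, symmetric
  digraphs without parallel arcs. An undirected edge is a pair of mutually inverse arcs, so the
  degree of a vertex is its out-degree, and an undirected subgraph is a subgraph that is itself a
  \<^locale>\<open>graph\<close>; such a subgraph contains an edge iff it contains either of the two arcs.
\<close>

text \<open>Unspecified if there are no vertices; the null graph has no edge to cover.\<close>

definition min_degree :: "('a, 'b) pre_digraph \<Rightarrow> nat" where
  "min_degree G = Min (out_degree G ` verts G)"

text \<open>\<open>K\<^bsub>1,r\<^esub> H\<close> is invariant under isomorphism: it says that \<open>H\<close> is some copy of the star.\<close>

definition star_free :: "nat \<Rightarrow> ('a, 'b) pre_digraph \<Rightarrow> bool" where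
  "star_free r G \<longleftrightarrow> \<not> (\<exists>H. induced_subgraph H G \<and> K\<^bsub>1,r\<^esub> H)"

text \<open>The whole graph is a path, here the one visiting the vertices in the order of \<open>p\<close>.\<close>

definition path_graph :: "('a, 'b) pre_digraph \<Rightarrow> bool" where
  "path_graph P \<longleftrightarrow> graph P \<and>
    (\<exists>p. p \<noteq> [] \<and> distinct p \<and> verts P = set p \<and>
         arcs_ends P = set (vwalk_arcs p) \<union> (set (vwalk_arcs p))\<inverse>)"

text \<open>The strongly connected components of a symmetric digraph are its connected components.\<close>

definition path_factor :: "nat \<Rightarrow> ('a, 'b) pre_digraph \<Rightarrow> ('a, 'b) pre_digraph \<Rightarrow> bool" where
  "path_factor k F G \<longleftrightarrow> graph F \<and> spanning F G \<and>
    (\<forall>C \<in> pre_digraph.sccs F. path_graph C \<and> k \<le> card (verts C))"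

definition path_factor_covered :: "nat \<Rightarrow> ('a, 'b) pre_digraph \<Rightarrow> bool" where
  "path_factor_covered k G \<longleftrightarrow> (\<forall>e \<in> arcs G. \<exists>F. path_factor k F G \<and> e \<in> arcs F)"

end

theory Submission
  imports Defs
begin

text \<open>
  Fix an edge \<open>uv\<close>. If every vertex \<open>x\<close> picks a neighbour \<open>f x\<close> such that no vertex is picked more
  than twice, \<open>f u = v\<close> and \<open>f v = u\<close>, then the functional graph of \<open>f\<close> contains a path factor
  through \<open>uv\<close>: a vertex whose preimages are all leaves is split off together with them, and once no
  such vertex is left, the non-leaves are permuted by \<open>f\<close> and carry at most one leaf each.

  By Hall's theorem such an \<open>f\<close> exists as soon as \<open>|I| + 2 \<le> 2 |N(I)|\<close> for every nonempty
  independent set \<open>I\<close>; the \<open>2\<close> pays for \<open>f u\<close> and \<open>f v\<close> being prescribed. With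
  \<open>m = \<lfloor>r/2\<rfloor> + 1\<close>, counting the edges leaving \<open>I\<close> gives \<open>m |I| \<le> (r - 1) |N(I)| \<le> (2 m - 2) |N(I)|\<close>,
  and \<open>|N(I)| \<ge> m\<close>.
\<close>

section \<open>Vertex-disjoint paths covering a set\<close>

text \<open>\<open>E\<close> is a directed relation: covers along a successor map must remember the
  direction of their arcs.\<close>

definition path_cover :: "('a \<times> 'a) set \<Rightarrow> 'a set \<Rightarrow> 'a list set \<Rightarrow> bool" where
  "path_cover E X P \<longleftrightarrow>
    (\<forall>p\<in>P. 2 \<le> length p \<and> distinct p \<and> set (vwalk_arcs p) \<subseteq> E) \<and>
    (\<forall>p\<in>P. \<forall>q\<in>P. p \<noteq> q \<longrightarrow> set p \<inter> set q = {}) \<and> (\<Union>p\<in>P. set p) = X"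

lemma path_cover_empty: "path_cover E {} {}"
  by (simp add: path_cover_def)

lemma path_cover_mono: "path_cover E X P \<Longrightarrow> E \<subseteq> E' \<Longrightarrow> path_cover E' X P"
  unfolding path_cover_def by blast

lemma path_cover_insert:
  assumes "path_cover E X P" "2 \<le> length p" "distinct p" "set (vwalk_arcs p) \<subseteq> E"
    "set p \<inter> X = {}"
  shows "path_cover E (set p \<union> X) (insert p P)"
proof -
  have "set p \<inter> set q = {}" if "q \<in> P" for q
    using assms(1,5) that unfolding path_cover_def by blast
  then show ?thesis
    using assms unfolding path_cover_def by auto
qed

lemma vwalk_arcs_predecessor:
  assumes "y \<in> set p" "y \<noteq> hd p"
  obtains z where "(z, y) \<in> set (vwalk_arcs p)"
proof -
  obtain xs ys where p: "p = xs @ y # ys" using assms(1) by (meson split_list)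
  then have "xs \<noteq> []" using assms(2) by auto
  then have "(last xs, y) \<in> set (vwalk_arcs p)" unfolding p by (simp add: vwalk_arcs_append)
  then show ?thesis using that by blast
qed

lemma vwalk_arcs_in_set:
  "(a, b) \<in> set (vwalk_arcs p) \<Longrightarrow> a \<in> set p \<and> b \<in> set p"
  by (induction p rule: vwalk_arcs.induct) auto

text \<open>The arcs from \<open>x\<close> to \<open>s x\<close> have in-degree and out-degree at
  most one, so they form paths and cycles; dropping one arc of a cycle leaves a path on the same
  vertices.\<close>

lemma path_cover_injective_map:
  assumes "finite X" "inj_on s X" "\<forall>x\<in>X. s x \<noteq> x"
  shows "\<exists>P. path_cover ((\<lambda>x. (x, s x)) ` X) (X \<union> s ` X) P"
  using assms
proof (induction "card X" arbitrary: X rule: less_induct)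
  case less
  have rest: "\<exists>P. path_cover ((\<lambda>x. (x, s x)) ` X) (X - {x} \<union> s ` (X - {x})) P" if "x \<in> X" for x
  proof -
    have "\<exists>P. path_cover ((\<lambda>x. (x, s x)) ` (X - {x})) (X - {x} \<union> s ` (X - {x})) P"
      using less.hyps[OF card_Diff1_less[OF less.prems(1) that]] less.prems
      by (simp add: inj_on_diff)
    then show ?thesis by (meson Diff_subset image_mono path_cover_mono)
  qed
  \<comment> \<open>Either nothing is to be covered, or \<open>s\<close> permutes \<open>X\<close>,
    or some \<open>x\<close> has no predecessor and can start a path.\<close>
  consider "X = {}" | x where "x \<in> X" "X \<subseteq> s ` X" | x where "x \<in> X" "x \<notin> s ` X" by blast
  then show ?case
  proof cases
    case 1
    then show ?thesis using path_cover_empty by auto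
  next
    case 2
    have im: "s ` X = X"
      using card_seteq[of "s ` X" X] 2 less.prems(1) by (simp add: card_image_le)
    \<comment> \<open>\<open>x\<close> is still the successor of some \<open>z\<close> other than
      \<open>x\<close>, so dropping the arc that leaves \<open>x\<close> opens a cycle without
      losing a vertex.\<close>
    obtain z where z: "z \<in> X" "x = s z" using 2 by blast
    then have "z \<in> X - {x}" using less.prems(3) by auto
    then have "x \<in> s ` (X - {x})" using z(2) by (metis imageI)
    then have "X - {x} \<union> s ` (X - {x}) = X" using im 2(1) by blast
    then have "X - {x} \<union> s ` (X - {x}) = X \<union> s ` X" unfolding im by simp
    then show ?thesis using rest[OF 2(1)] by simp
  next
    case 3
    define Y where "Y = X - {x} \<union> s ` (X - {x})"
    obtain P where P: "path_cover ((\<lambda>x. (x, s x)) ` (X - {x})) Y P"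
      using less.hyps[OF card_Diff1_less[OF less.prems(1) 3(1)]] less.prems unfolding Y_def
      by (auto simp add: inj_on_diff)
    have P': "path_cover ((\<lambda>x. (x, s x)) ` X) Y P"
      using P by (rule path_cover_mono) auto
    have xY: "x \<notin> Y" using 3 by (auto simp: Y_def)
    have XY: "X \<union> s ` X = insert x (insert (s x) Y)" using 3 by (auto simp: Y_def)
    show ?thesis
    proof (cases "s x \<in> Y")
      case False
      have "path_cover ((\<lambda>x. (x, s x)) ` X) (set [x, s x] \<union> Y) (insert [x, s x] P)"
        by (rule path_cover_insert[OF P']) (use 3 False xY less.prems(3) in auto)
      then show ?thesis using XY by auto
    next
      case True
      then obtain p where p: "p \<in> P" "s x \<in> set p" using P unfolding path_cover_def by blast
      have arcs: "set (vwalk_arcs p) \<subseteq> (\<lambda>x. (x, s x)) ` (X - {x})"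
        and len: "2 \<le> length p" and dist: "distinct p"
        using P p unfolding path_cover_def by auto
      \<comment> \<open>A predecessor of \<open>s x\<close> on \<open>p\<close> would be a second
        element of \<open>X\<close> mapped to \<open>s x\<close>. So \<open>p\<close> begins at
        \<open>s x\<close>, and \<open>x\<close> can be put in front.\<close>
      have hd: "hd p = s x"
      proof (rule ccontr)
        assume "hd p \<noteq> s x"
        then obtain z where "(z, s x) \<in> set (vwalk_arcs p)"
          using vwalk_arcs_predecessor p(2) by metis
        then have "z \<in> X - {x}" "s z = s x" using arcs by auto
        then show False using less.prems(2) 3 by (auto dest: inj_onD)
      qed
      have pY: "set p \<subseteq> Y" using P p(1) unfolding path_cover_def by blast
      have P1: "path_cover ((\<lambda>x. (x, s x)) ` X) (Y - set p) (P - {p})"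
        using P' p(1) unfolding path_cover_def by blast
      have "path_cover ((\<lambda>x. (x, s x)) ` X) (set (x # p) \<union> (Y - set p)) (insert (x # p) (P - {p}))"
      proof (rule path_cover_insert[OF P1])
        show "set (vwalk_arcs (x # p)) \<subseteq> (\<lambda>x. (x, s x)) ` X"
          using arcs hd 3 len by (cases p) auto
      qed (use len dist xY pY in auto)
      moreover have "set (x # p) \<union> (Y - set p) = X \<union> s ` X" using XY True pY by auto
      ultimately show ?thesis by auto
    qed
  qed
qed

lemma card_le_1_list:
  assumes "finite D" "card D \<le> 1"
  obtains ds where "set ds = D" "ds = [] \<or> (\<exists>d. ds = [d])"
proof (cases "D = {}")
  case True
  then show ?thesis using that[of "[]"] by simp
next
  case False
  then have "card D = 1" using assms by (simp add: le_Suc_eq)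
  then obtain d where "D = {d}" by (meson card_1_singletonE)
  then show ?thesis using that[of "[d]"] by simp
qed

section \<open>Path covers from functional graphs\<close>

text \<open>The vertices \<open>u\<close> and \<open>v\<close> form a two-cycle of \<open>f\<close>.
  Being in the image, they survive every splitting and end up as consecutive vertices of one
  path.\<close>

lemma path_cover_functional_graph:
  assumes "finite X" "\<forall>x\<in>X. f x \<in> X" "\<forall>x\<in>X. (x, f x) \<in> E" "sym E" "irrefl E"
    "\<forall>y. card {x\<in>X. f x = y} \<le> 2" "u \<in> X" "v \<in> X" "f u = v" "f v = u"
  shows "\<exists>P. path_cover E X P \<and> (\<exists>p\<in>P. (u, v) \<in> set (vwalk_arcs p))"
  using assms
proof (induction "card X" arbitrary: X rule: less_induct)
  case less
  note fin = less.prems(1) and closed = less.prems(2) and adj = less.prems(3)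
    and fibre = less.prems(6) and uv = less.prems(7-10)
  have adj': "(f x, x) \<in> E" if "x \<in> X" for x using adj \<open>sym E\<close> that by (meson symD)
  have noloop: "(x, x) \<notin> E" for x using \<open>irrefl E\<close> by (simp add: irrefl_def)
  have fixfree: "f x \<noteq> x" if "x \<in> X" for x using adj that noloop by metis
  have imuv: "u \<in> f ` X" "v \<in> f ` X" using uv by (metis imageI)+
  show ?case
  proof (cases "\<exists>y \<in> f ` X. {x\<in>X. f x = y} \<inter> f ` X = {}")
    case True
    then obtain y where y: "y \<in> f ` X" and C0: "{x\<in>X. f x = y} \<inter> f ` X = {}" by blast
    define C where "C = {x\<in>X. f x = y}"
    have C: "C \<inter> f ` X = {}" "C \<subseteq> X" "y \<in> X" "y \<notin> C" "finite C" "C \<noteq> {}" "card C \<le> 2"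
      using C0 y closed fixfree fin fibre by (auto simp: C_def)
    \<comment> \<open>\<open>v\<close> lies in the image and is a preimage of \<open>u\<close>, and
      conversely; so neither of them is the \<open>y\<close> to be split off.\<close>
    have yuv: "y \<noteq> u" "y \<noteq> v" using C0 uv imuv by auto
    have Cuv: "u \<notin> C" "v \<notin> C" using C imuv by blast+
    \<comment> \<open>\<open>C\<close> has one or two elements, so \<open>y\<close> together with
      its leaves is a path, with \<open>y\<close> at an end or in the middle.\<close>
    obtain p where p: "set p = insert y C" "distinct p" "2 \<le> length p" "set (vwalk_arcs p) \<subseteq> E"
    proof -
      obtain c where c: "c \<in> C" using C by blast
      have "card (C - {c}) \<le> 1" using C c by (simp add: card_Diff_singleton)
      then obtain ds where ds: "set ds = C - {c}" "ds = [] \<or> (\<exists>d. ds = [d])"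
        using card_le_1_list C by (metis finite_Diff)
      have CE: "(x, y) \<in> E" "(y, x) \<in> E" if "x \<in> C" for x
        using adj adj' that unfolding C_def by auto
      show ?thesis
        using ds(2)
      proof (elim disjE exE)
        assume "ds = []"
        then show ?thesis using ds(1) c C CE by (intro that[of "[c, y]"]) auto
      next
        fix d assume "ds = [d]"
        then have d: "C = {c, d}" "d \<noteq> c" using ds(1) c by auto
        then show ?thesis using C CE by (intro that[of "[c, y, d]"]) auto
      qed
    qed
    let ?X = "X - set p"
    have "card ?X < card X" using p C fin by (intro psubset_card_mono) auto
    \<comment> \<open>Vertices outside \<open>C\<close> are not mapped to \<open>y\<close>, and no
      vertex is mapped into \<open>C\<close>, so the rest is closed under \<open>f\<close>.\<close>
    moreover have "\<forall>x\<in>?X. f x \<in> ?X"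
      using closed C p by (auto simp: C_def)
    moreover have "\<forall>z. card {x\<in>?X. f x = z} \<le> 2"
    proof
      fix z
      have "card {x\<in>?X. f x = z} \<le> card {x\<in>X. f x = z}"
        using fin by (intro card_mono) auto
      then show "card {x\<in>?X. f x = z} \<le> 2" using fibre le_trans by blast
    qed
    ultimately obtain P where P: "path_cover E ?X P" "\<exists>p\<in>P. (u, v) \<in> set (vwalk_arcs p)"
      using less.hyps[of ?X] less.prems yuv Cuv p(1) by auto
    have "path_cover E (set p \<union> ?X) (insert p P)"
      by (rule path_cover_insert[OF P(1)]) (use p in auto)
    moreover have "set p \<union> ?X = X" using p(1) C by auto
    ultimately show ?thesis using P(2) by (metis insertI2)
  next
    case False
    define Z where "Z = f ` X"
    have ZX: "Z \<subseteq> X" and finZ: "finite Z" using closed fin by (auto simp: Z_def)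
    \<comment> \<open>Every vertex of \<open>Z\<close> now has a preimage in \<open>Z\<close>; by
      finiteness \<open>f\<close> permutes \<open>Z\<close>.\<close>
    have Zim: "f ` Z = Z"
    proof
      show "f ` Z \<subseteq> Z" using ZX unfolding Z_def by blast
      show "Z \<subseteq> f ` Z"
      proof
        fix y assume "y \<in> Z"
        then have "{x\<in>X. f x = y} \<inter> Z \<noteq> {}" using False unfolding Z_def by blast
        then show "y \<in> f ` Z" by auto
      qed
    qed
    have injZ: "inj_on f Z" using Zim finZ by (simp add: eq_card_imp_inj_on)
    have uvZ: "u \<in> Z" "v \<in> Z" using imuv by (auto simp: Z_def)
    define D where "D y = {x \<in> X - Z. f x = y}" for y
    \<comment> \<open>One of the at most two preimages of \<open>y\<close> lies in \<open>Z\<close>,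
      which leaves room for at most one leaf.\<close>
    have D: "finite (D y)" "card (D y) \<le> 1" if y: "y \<in> Z" for y
    proof -
      show "finite (D y)" using fin by (simp add: D_def)
      have "y \<in> f ` Z" using y by (simp add: Zim)
      then obtain z where z: "z \<in> Z" "f z = y" by auto
      have "insert z (D y) \<subseteq> {x\<in>X. f x = y}" using z ZX by (auto simp: D_def)
      then have "card (insert z (D y)) \<le> card {x\<in>X. f x = y}"
        using fin by (intro card_mono) auto
      then have "card (insert z (D y)) \<le> 2" using fibre le_trans by blast
      moreover have "z \<notin> D y" using z by (simp add: D_def)
      ultimately show "card (D y) \<le> 1" using \<open>finite (D y)\<close> by simp
    qed
    \<comment> \<open>The paths follow \<open>f\<close> and turn off into a leaf at the first vertex that carries one. This makes
      the successor map \<open>s\<close> injective.\<close>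
    define s where "s y = (if D y = {} then f y else SOME x. x \<in> D y)" for y
    have sD: "s y \<in> D y" if "D y \<noteq> {}" for y using that by (auto simp: s_def some_in_eq)
    have Deq: "D y = {s y}" if "D y \<noteq> {}" "y \<in> Z" for y
      using sD[OF that(1)] D[OF that(2)] by (auto simp: card_le_Suc0_iff_eq)
    \<comment> \<open>The two-cycle on \<open>u\<close> and \<open>v\<close> is treated apart: along
      \<open>s\<close>, the arc from \<open>u\<close> to \<open>v\<close> could be lost to a leaf or
      to the opening of the cycle.\<close>
    let ?Z = "Z - {u, v}"
    have "inj_on s ?Z"
    proof (rule inj_onI)
      fix a b assume a: "a \<in> ?Z" and b: "b \<in> ?Z" and eq: "s a = s b"
      consider "D a = {}" "D b = {}" | "D a \<noteq> {}" "D b \<noteq> {}" | "D a = {}" "D b \<noteq> {}"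
        | "D a \<noteq> {}" "D b = {}" by blast
      then show "a = b"
      proof cases
        case 1
        then show ?thesis using a b eq injZ by (auto simp: s_def dest: inj_onD)
      next
        case 2
        then show ?thesis using sD[of a] sD[of b] eq by (auto simp: D_def)
      next
        case 3
        then have "s a \<in> Z" "s b \<notin> Z" using a sD[of b] Zim by (auto simp: s_def D_def)
        then show ?thesis using eq by simp
      next
        case 4
        then have "s b \<in> Z" "s a \<notin> Z" using b sD[of a] Zim by (auto simp: s_def D_def)
        then show ?thesis using eq by simp
      qed
    qed
    moreover have sE: "(y, s y) \<in> E" if "y \<in> Z" for y
    proof (cases "D y = {}")
      case True
      then show ?thesis using adj ZX that by (auto simp: s_def)
    next
      case False
      then have "s y \<in> X" "f (s y) = y" using sD[of y] by (auto simp: D_def)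
      then show ?thesis using adj'[of "s y"] by simp
    qed
    then have "\<forall>y\<in>?Z. s y \<noteq> y" using noloop by (metis DiffD1)
    ultimately obtain P0 where "path_cover ((\<lambda>x. (x, s x)) ` ?Z) (?Z \<union> s ` ?Z) P0"
      using path_cover_injective_map[of ?Z s] finZ by auto
    then have P0: "path_cover E (?Z \<union> s ` ?Z) P0"
      by (rule path_cover_mono) (use sE in auto)
    obtain us where us: "set us = D u" "us = [] \<or> (\<exists>d. us = [d])"
      using card_le_1_list D uvZ by metis
    obtain vs where vs: "set vs = D v" "vs = [] \<or> (\<exists>d. vs = [d])"
      using card_le_1_list D uvZ by metis
    have uE: "(x, u) \<in> E" if "x \<in> D u" for x using adj that by (auto simp: D_def)
    have vE: "(v, x) \<in> E" if "x \<in> D v" for x using adj' that by (auto simp: D_def)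
    have uvE: "(u, v) \<in> E" "u \<noteq> v"
      using adj uv(1,3) fixfree[OF uv(1)] by auto
    \<comment> \<open>The prescribed edge, extended at each end by the leaf there, if any.\<close>
    define p where "p = us @ u # v # vs"
    have setp: "set p = D u \<union> D v \<union> {u, v}" using us vs by (auto simp: p_def)
    have Ds: "D u \<inter> D v = {}" "D y \<inter> Z = {}" for y using uvE by (auto simp: D_def)
    have arcsp: "set (vwalk_arcs p) \<subseteq> E"
      unfolding p_def using us(2) vs(2)
      by (elim disjE exE) (use us(1) vs(1) uE vE uvE in auto)
    have uvp: "(u, v) \<in> set (vwalk_arcs p)"
      unfolding p_def using us(2) vs(2) by (elim disjE exE) auto
    have uvD: "u \<notin> D u" "u \<notin> D v" "v \<notin> D u" "v \<notin> D v" using Ds uvZ by blast+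
    have "distinct us" "distinct vs" using us(2) vs(2) by auto
    then have distp: "distinct p"
      using us(1) vs(1) uvE(2) Ds(1) uvD by (simp add: p_def)
    \<comment> \<open>On \<open>Z\<close> the injective \<open>f\<close> already takes the values
      \<open>u\<close> and \<open>v\<close> at \<open>v\<close> and \<open>u\<close>, and a leaf
      belongs to only one vertex.\<close>
    have sZ: "s y \<notin> set p" if "y \<in> ?Z" for y
    proof (cases "D y = {}")
      case True
      then have "s y = f y" by (simp add: s_def)
      moreover have "f y \<noteq> u" "f y \<noteq> v"
        using that uvZ uv injZ by (metis DiffE insertCI inj_onD)+
      moreover have "f y \<in> Z" using Zim that by auto
      ultimately show ?thesis using setp Ds by auto
    next
      case False
      then have "s y \<in> D y" by (rule sD)
      then show ?thesis using that uvZ by (auto simp: setp D_def)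
    qed
    have "path_cover E (set p \<union> (?Z \<union> s ` ?Z)) (insert p P0)"
    proof (rule path_cover_insert[OF P0])
      show "2 \<le> length p" by (simp add: p_def)
      have "set p \<inter> ?Z = {}" using Ds(2) setp by blast
      then show "set p \<inter> (?Z \<union> s ` ?Z) = {}" using sZ by blast
    qed (fact distp arcsp)+
    moreover have "set p \<union> (?Z \<union> s ` ?Z) = X"
    proof
      have "s y \<in> X" if "y \<in> Z" for y
        using sD[of y] that closed ZX by (cases "D y = {}") (auto simp: s_def D_def)
      then show "set p \<union> (?Z \<union> s ` ?Z) \<subseteq> X"
        using ZX uv by (auto simp: setp D_def)
      show "X \<subseteq> set p \<union> (?Z \<union> s ` ?Z)"
      proof
        fix x assume x: "x \<in> X"
        show "x \<in> set p \<union> (?Z \<union> s ` ?Z)"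
        proof (cases "x \<in> Z")
          case True
          then show ?thesis by (auto simp: setp)
        next
          case False
          then have "x \<in> D (f x)" "f x \<in> Z" using x by (auto simp: D_def Z_def)
          \<comment> \<open>The only leaf at \<open>f x\<close> is \<open>x\<close>, so it lies on
            \<open>p\<close> or is the successor of a vertex of \<open>?Z\<close>.\<close>
          then have "x = s (f x)" using Deq by blast
          then show ?thesis using \<open>x \<in> D (f x)\<close> \<open>f x \<in> Z\<close> setp by auto
        qed
      qed
    qed
    ultimately show ?thesis using uvp by (metis insertI1)
  qed
qed

section \<open>Hall's marriage theorem\<close>

text \<open>Induction on \<open>card A\<close>: a tight proper nonempty subset splits the problem
  into two smaller ones; if there is none, any element can be matched to any of its
  candidates.\<close>

lemma hall_marriage:
  assumes "finite A" "\<forall>x\<in>A. finite (N x)" "\<forall>S\<subseteq>A. card S \<le> card (\<Union>x\<in>S. N x)"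
  shows "\<exists>f. inj_on f A \<and> (\<forall>x\<in>A. f x \<in> N x)"
  using assms
proof (induction "card A" arbitrary: A N rule: less_induct)
  case less
  note fin = less.prems(1) and finN = less.prems(2) and hall = less.prems(3)
  show ?case
  proof (cases "\<exists>S. S \<subset> A \<and> S \<noteq> {} \<and> card (\<Union>x\<in>S. N x) = card S")
    case True
    then obtain S where S: "S \<subset> A" "S \<noteq> {}" "card (\<Union>x\<in>S. N x) = card S" by blast
    have finS: "finite S" using S fin finite_subset by blast
    have "\<exists>f. inj_on f S \<and> (\<forall>x\<in>S. f x \<in> N x)"
    proof (rule less.hyps[of S N])
      show "card S < card A" using fin S(1) by (rule psubset_card_mono)
    qed (use S finS finN hall in auto)
    then obtain f where f: "inj_on f S" "\<forall>x\<in>S. f x \<in> N x" by blast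
    define U where "U = (\<Union>x\<in>S. N x)"
    have "\<exists>g. inj_on g (A - S) \<and> (\<forall>x\<in>A - S. g x \<in> N x - U)"
    proof (rule less.hyps[of "A - S" "\<lambda>x. N x - U"])
      show "card (A - S) < card A" using S fin by (intro psubset_card_mono) auto
      \<comment> \<open>Hall's condition for \<open>T \<union> S\<close>, less the tight set
        \<open>S\<close>, is the condition for \<open>T\<close> outside \<open>U\<close>.\<close>
      show "\<forall>T\<subseteq>A - S. card T \<le> card (\<Union>x\<in>T. N x - U)"
      proof (intro allI impI)
        fix T assume T: "T \<subseteq> A - S"
        have "card T + card S = card (T \<union> S)"
          using T fin finS by (subst card_Un_disjoint) (auto intro: finite_subset)
        also have "\<dots> \<le> card (\<Union>x\<in>T \<union> S. N x)" using hall T S by (metis Diff_subset le_sup_iff psubset_imp_subset subset_trans)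
        also have "(\<Union>x\<in>T \<union> S. N x) = (\<Union>x\<in>T. N x - U) \<union> U" by (auto simp: U_def)
        also have "card \<dots> \<le> card (\<Union>x\<in>T. N x - U) + card U" by (rule card_Un_le)
        finally show "card T \<le> card (\<Union>x\<in>T. N x - U)" using S(3) by (simp add: U_def)
      qed
    qed (use fin finN in auto)
    then obtain g where g: "inj_on g (A - S)" "\<forall>x\<in>A - S. g x \<in> N x - U" by blast
    let ?h = "\<lambda>x. if x \<in> S then f x else g x"
    have fU: "f x \<in> U" if "x \<in> S" for x using f(2) that by (auto simp: U_def)
    have "inj_on ?h A"
    proof (rule inj_onI)
      fix x y assume "x \<in> A" "y \<in> A" "?h x = ?h y"
      then show "x = y" using f(1) g fU
        by (cases "x \<in> S"; cases "y \<in> S") (simp_all, (metis Diff_iff inj_onD)+)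
    qed
    moreover have "\<forall>x\<in>A. ?h x \<in> N x" using f(2) g(2) by auto
    ultimately show ?thesis by blast
  next
    case False
    show ?thesis
    proof (cases "A = {}")
      case True
      then show ?thesis by simp
    next
      case False
      then obtain a where a: "a \<in> A" by blast
      have "card {a} \<le> card (\<Union>x\<in>{a}. N x)" using hall a by blast
      then have "N a \<noteq> {}" by auto
      then obtain b where b: "b \<in> N a" by blast
      have "\<exists>g. inj_on g (A - {a}) \<and> (\<forall>x\<in>A - {a}. g x \<in> N x - {b})"
      proof (rule less.hyps[of "A - {a}" "\<lambda>x. N x - {b}"])
        show "card (A - {a}) < card A" using a fin by (rule card_Diff1_less[rotated])
        show "\<forall>T\<subseteq>A - {a}. card T \<le> card (\<Union>x\<in>T. N x - {b})"
        proof (intro allI impI)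
          fix T assume T: "T \<subseteq> A - {a}"
          show "card T \<le> card (\<Union>x\<in>T. N x - {b})"
          proof (cases "T = {}")
            case False
            \<comment> \<open>\<open>T\<close> misses \<open>a\<close> and is not tight, so it has a
              candidate to spare, which pays for the loss of \<open>b\<close>.\<close>
            then have "card (\<Union>x\<in>T. N x) \<noteq> card T" "card T \<le> card (\<Union>x\<in>T. N x)"
              using T a hall \<open>\<not> (\<exists>S. S \<subset> A \<and> S \<noteq> {} \<and> card (\<Union>x\<in>S. N x) = card S)\<close> by blast+
            then have "card T < card (\<Union>x\<in>T. N x)" by simp
            also have "\<dots> \<le> Suc (card ((\<Union>x\<in>T. N x) - {b}))"
              using diff_card_le_card_Diff[of "{b}" "\<Union>x\<in>T. N x"] by simp
            also have "(\<Union>x\<in>T. N x) - {b} = (\<Union>x\<in>T. N x - {b})" by auto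
            finally show ?thesis by simp
          qed simp
        qed
      qed (use fin finN in auto)
      then obtain g where g: "inj_on g (A - {a})" "\<forall>x\<in>A - {a}. g x \<in> N x - {b}" by blast
      have "inj_on (g(a := b)) A"
      proof (rule inj_onI)
        fix x y assume "x \<in> A" "y \<in> A" "(g(a := b)) x = (g(a := b)) y"
        then show "x = y" using g by (auto split: if_splits dest: inj_onD)
      qed
      moreover have "\<forall>x\<in>A. (g(a := b)) x \<in> N x" using g(2) b by auto
      ultimately show ?thesis by blast
    qed
  qed
qed

section \<open>Choosing the map by Hall's theorem\<close>

text \<open>Independent sets suffice in Hall's condition: a vertex of \<open>S\<close> with a
  neighbour in \<open>S\<close> is itself a neighbour of \<open>S\<close> and brings two slots of
  its own.\<close>

lemma exists_functional_graph:
  assumes "finite V" "E \<subseteq> V \<times> V" "sym E" "irrefl E" "(u, v) \<in> E"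
    and indep: "\<And>I. I \<subseteq> V \<Longrightarrow> I \<noteq> {} \<Longrightarrow> E \<inter> I \<times> I = {} \<Longrightarrow> card I + 2 \<le> 2 * card (E `` I)"
  shows "\<exists>f. (\<forall>x\<in>V. (x, f x) \<in> E) \<and> (\<forall>y. card {x\<in>V. f x = y} \<le> 2) \<and> f u = v \<and> f v = u"
proof -
  have uv: "u \<noteq> v" "u \<in> V" "v \<in> V" using assms(2,4,5) by (auto simp: irrefl_def)
  have finE: "finite (E `` S)" for S using assms(1) finite_subset[OF Image_subset[OF assms(2)]] by blast
  \<comment> \<open>Each vertex can be picked twice; one slot of \<open>u\<close> and one of \<open>v\<close> are reserved for each other.\<close>
  define slots where "slots S = (E `` S) \<times> (UNIV :: bool set) - {u, v} \<times> {False}" for S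
  have fin_slots: "finite (slots S)" for S using finE by (simp add: slots_def)
  define A where "A = V - {u, v}"
  have UN: "(\<Union>x\<in>S. slots {x}) = slots S" for S by (auto simp: slots_def)
  have hall: "card S \<le> card (slots S)" if S: "S \<subseteq> A" for S
  proof -
    have finS: "finite S" using S assms(1) by (auto simp: A_def intro: finite_subset)
    define I where "I = {x\<in>S. E `` {x} \<inter> S = {}}"
    define J where "J = S - I"
    have JE: "J \<subseteq> E `` S"
      using \<open>sym E\<close> by (auto simp: I_def J_def dest: symD)
    \<comment> \<open>Both slots are available, since \<open>u\<close> and \<open>v\<close> are not
      in \<open>A\<close>.\<close>
    have Jslots: "J \<times> UNIV \<subseteq> slots S" using JE S by (auto simp: slots_def J_def A_def)
    have cardJ: "card (J \<times> (UNIV :: bool set)) = 2 * card J" by (simp add: card_cartesian_product)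
    have cardS: "card S = card I + card J"
      using finS by (simp add: J_def I_def card_Diff_subset card_mono)
    have I: "card I \<le> card (slots I)"
    proof (cases "I = {}")
      case False
      have "card I + 2 \<le> 2 * card (E `` I)"
        by (rule indep) (use S False in \<open>auto simp: I_def A_def\<close>)
      also have "\<dots> = card ((E `` I) \<times> (UNIV :: bool set))" by (simp add: card_cartesian_product)
      also have "\<dots> \<le> card (slots I) + card ({u, v} \<times> {False})"
        unfolding slots_def using diff_card_le_card_Diff[of "{u, v} \<times> {False}" "(E `` I) \<times> UNIV"] by simp
      also have "card ({u, v} \<times> {False}) = 2" using uv by (simp add: card_cartesian_product)
      finally show ?thesis by simp
    qed simp
    \<comment> \<open>No vertex of \<open>I\<close> has a neighbour in \<open>S\<close>, so the
      slots of \<open>J\<close> have not been counted for \<open>I\<close>.\<close>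
    have "slots I \<inter> J \<times> UNIV = {}" by (auto simp: slots_def I_def J_def)
    then have "card (slots I) + 2 * card J = card (slots I \<union> J \<times> UNIV)"
      using finS fin_slots cardJ by (subst card_Un_disjoint) (auto simp: J_def)
    also have "\<dots> \<le> card (slots S)"
      using Jslots fin_slots by (intro card_mono) (auto simp: slots_def I_def)
    finally show ?thesis using I cardS by simp
  qed
  obtain g where g: "inj_on g A" "\<forall>x\<in>A. g x \<in> slots {x}"
    using hall_marriage[of A "\<lambda>x. slots {x}"] assms(1) fin_slots hall UN by (auto simp: A_def)
  \<comment> \<open>\<open>u\<close> and \<open>v\<close> take exactly the two reserved slots, which
    \<open>g\<close> avoids on \<open>A\<close>.\<close>
  define h where "h = g(u := (v, False), v := (u, False))"
  have h: "inj_on h V"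
  proof (rule inj_onI)
    fix x y assume "x \<in> V" "y \<in> V" "h x = h y"
    then show "x = y" using g uv
      by (auto simp: h_def A_def slots_def split: if_splits dest: inj_onD)
  qed
  have "card {x\<in>V. fst (h x) = y} \<le> 2" for y
  proof -
    have "card {x\<in>V. fst (h x) = y} \<le> card ({y} \<times> (UNIV :: bool set))"
      using h by (intro card_inj_on_le[of h]) (auto intro: inj_on_subset simp: prod_eq_iff)
    then show ?thesis by (simp add: card_cartesian_product)
  qed
  moreover have "(x, fst (h x)) \<in> E" if "x \<in> V" for x
  proof -
    have "g x \<in> slots {x}" if "x \<noteq> u" "x \<noteq> v"
      using g(2) \<open>x \<in> V\<close> that by (simp add: A_def)
    then show ?thesis
      using symD[OF assms(3,5)] assms(5) by (auto simp: h_def slots_def)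
  qed
  ultimately show ?thesis
    using uv by (intro exI[of _ "fst \<circ> h"]) (auto simp: h_def)
qed

section \<open>Counting neighbours\<close>

lemma card_neighbours_lower_bound:
  assumes "finite I" "finite (E `` I)" "I \<noteq> {}"
    and deg: "\<forall>x\<in>I. m \<le> card (E `` {x})"
    and star: "\<forall>w. card {x\<in>I. (x, w) \<in> E} \<le> k"
    and km: "k + 2 \<le> 2 * m"
  shows "card I + 2 \<le> 2 * card (E `` I)"
proof -
  let ?T = "E `` I"
  obtain x where x: "x \<in> I" using assms(3) by blast
  have "E `` {x} \<subseteq> ?T" using x by auto
  then have mT: "m \<le> card ?T" using deg x assms(2) by (meson card_mono le_trans)
  have "card I * m \<le> (\<Sum>x\<in>I. card {w\<in>?T. (x, w) \<in> E})"
  proof -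
    have "{w\<in>?T. (x, w) \<in> E} = E `` {x}" if "x \<in> I" for x using that by auto
    then show ?thesis using sum_bounded_below[of I m "\<lambda>x. card {w\<in>?T. (x, w) \<in> E}"] deg by simp
  qed
  also have "\<dots> = (\<Sum>w\<in>?T. card {x\<in>I. (x, w) \<in> E})"
    by (rule sum_multicount_gen) (use assms in auto)
  also have "\<dots> \<le> card ?T * k"
    using sum_bounded_above[of ?T "\<lambda>w. card {x\<in>I. (x, w) \<in> E}" k] star by simp
  \<comment> \<open>Adding \<open>2 * card ?T\<close> raises \<open>k\<close> to
    \<open>k + 2\<close>, hence to at most \<open>2 * m\<close>; afterwards
    \<open>m \<le> card ?T\<close> turns the added term into the \<open>2\<close> beside
    \<open>card I\<close>.\<close>
  finally have "card I * m + 2 * card ?T \<le> card ?T * (k + 2)" by simp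
  also have "\<dots> \<le> card ?T * (2 * m)" using km by (rule mult_le_mono2)
  finally have "(card I + 2) * m \<le> (2 * card ?T) * m" using mT by (simp add: algebra_simps)
  moreover have "0 < m" using km by simp
  ultimately show ?thesis by (metis mult_le_cancel2)
qed

section \<open>From path covers to path factors\<close>

lemma hd_rtrancl_vwalk_arcs:
  "set (vwalk_arcs p) \<subseteq> R \<Longrightarrow> b \<in> set p \<Longrightarrow> (hd p, b) \<in> R\<^sup>*"
  by (induction p rule: vwalk_arcs.induct) (auto intro: converse_rtrancl_into_rtrancl)

lemma arcs_ends_induce_subgraph: "arcs_ends (G \<restriction> S) = arcs_ends G \<inter> S \<times> S"
  by (auto simp: arcs_ends_def arc_to_ends_def)

text \<open>No arc of \<open>R\<close> leaves a path of the cover, and each path is connected by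
  \<open>R\<close>, so the components of the spanning subgraph are the paths themselves.\<close>

lemma (in graph) path_factor_of_path_cover:
  assumes P: "path_cover (arcs_ends G) (verts G) P"
    and R: "R = (\<Union>p\<in>P. set (vwalk_arcs p) \<union> (set (vwalk_arcs p))\<inverse>)"
  shows "path_factor 2 (G\<lparr>arcs := {e \<in> arcs G. arc_to_ends G e \<in> R}\<rparr>) G"
proof -
  let ?F = "G\<lparr>arcs := {e \<in> arcs G. arc_to_ends G e \<in> R}\<rparr>"
  have "set (vwalk_arcs p) \<subseteq> arcs_ends G" if "p \<in> P" for p
    using P that by (simp add: path_cover_def)
  then have "R \<subseteq> arcs_ends G"
    using sym_arcs unfolding R symmetric_def by (blast dest: symD)
  then have ends: "arcs_ends ?F = R" by (auto simp: arcs_ends_def arc_to_ends_def)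
  have symR: "sym R" by (auto simp: R sym_def)
  have sub: "subgraph ?F G"
    by (intro subgraphI) (auto simp: compatible_def wf_digraph wf_digraph_def)
  interpret F: digraph ?F using sub by (rule digraph_subgraph)
  interpret F: graph ?F using symR ends by (intro F.graphI) (simp add: symmetric_def)
  have same: "q = p" if "p \<in> P" "q \<in> P" "x \<in> set p" "x \<in> set q" for p q x
    using P that unfolding path_cover_def by blast
  \<comment> \<open>A vertex lies on only one path, so every arc of \<open>R\<close> at it comes
    from that path.\<close>
  have R_set: "(a, b) \<in> set (vwalk_arcs p) \<union> (set (vwalk_arcs p))\<inverse>"
    if "(a, b) \<in> R" "p \<in> P" "a \<in> set p" for a b p
  proof -
    obtain q where "q \<in> P" "(a, b) \<in> set (vwalk_arcs q) \<union> (set (vwalk_arcs q))\<inverse>"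
      using \<open>(a, b) \<in> R\<close> by (auto simp: R)
    moreover from this have "q = p" using that same vwalk_arcs_in_set by fast
    ultimately show ?thesis by simp
  qed
  have stay: "b \<in> set p" if "(a, b) \<in> R\<^sup>*" "p \<in> P" "a \<in> set p" for a b p
    using that(1)
  proof induction
    case (step y z)
    then have "(y, z) \<in> set (vwalk_arcs p) \<union> (set (vwalk_arcs p))\<inverse>" using R_set that by blast
    then show ?case using vwalk_arcs_in_set by fast
  qed (use that in simp)
  have conn: "(a, b) \<in> R\<^sup>*" if "p \<in> P" "a \<in> set p" "b \<in> set p" for a b p
  proof -
    have "set (vwalk_arcs p) \<subseteq> R" using that(1) by (auto simp: R)
    \<comment> \<open>Both vertices are reached from the head of the path; symmetry of
      \<open>R\<close> reverses one of the two walks.\<close>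
    then have "(hd p, a) \<in> R\<^sup>*" "(hd p, b) \<in> R\<^sup>*" using that hd_rtrancl_vwalk_arcs by metis+
    then show ?thesis using sym_rtrancl[OF symR] by (meson rtrancl_trans symD)
  qed
  have PV: "set p \<subseteq> verts G" if "p \<in> P" for p using P that unfolding path_cover_def by blast
  have "path_graph C \<and> 2 \<le> card (verts C)" if sccC: "C \<in> F.sccs" for C
  proof -
    obtain x where x: "x \<in> verts G" and C: "C = ?F \<restriction> F.scc_of x"
      using sccC unfolding F.sccs_conv_sccs_verts F.sccs_verts_conv_scc_of by auto
    obtain p where p: "p \<in> P" "x \<in> set p" using x P unfolding path_cover_def by blast
    have scc: "F.scc_of x = set p"
    proof
      show "F.scc_of x \<subseteq> set p"
      proof
        fix y assume "y \<in> F.scc_of x"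
        then have "(x, y) \<in> R\<^sup>*" by (simp add: F.scc_of_def F.reachable_conv ends)
        then show "y \<in> set p" using p by (rule stay)
      qed
      show "set p \<subseteq> F.scc_of x"
      proof
        fix y assume y: "y \<in> set p"
        then have "(x, y) \<in> R\<^sup>*" "(y, x) \<in> R\<^sup>*" using conn p by blast+
        moreover have "y \<in> verts G" using y PV[OF p(1)] by blast
        ultimately show "y \<in> F.scc_of x"
          using x by (simp add: F.scc_of_def F.reachable_conv ends)
      qed
    qed
    have pp: "2 \<le> length p" "distinct p" using P p(1) unfolding path_cover_def by auto
    have "arcs_ends C = R \<inter> set p \<times> set p"
      by (simp add: C scc arcs_ends_induce_subgraph ends)
    also have "\<dots> = set (vwalk_arcs p) \<union> (set (vwalk_arcs p))\<inverse>"
    proof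
      show "R \<inter> set p \<times> set p \<subseteq> set (vwalk_arcs p) \<union> (set (vwalk_arcs p))\<inverse>"
        using R_set[OF _ p(1)] by blast
      have "set (vwalk_arcs p) \<subseteq> set p \<times> set p" using vwalk_arcs_in_set by fast
      moreover have "set (vwalk_arcs p) \<union> (set (vwalk_arcs p))\<inverse> \<subseteq> R"
        using p(1) unfolding R by blast
      ultimately show "set (vwalk_arcs p) \<union> (set (vwalk_arcs p))\<inverse> \<subseteq> R \<inter> set p \<times> set p"
        by blast
    qed
    finally have Cends: "arcs_ends C = set (vwalk_arcs p) \<union> (set (vwalk_arcs p))\<inverse>" .
    have vC: "verts C = set p" by (simp add: C scc)
    have indC: "induced_subgraph C ?F"
      unfolding C scc by (rule F.induced_induce) (use PV p in simp)
    then interpret C: digraph C by (rule F.digraphI_induced)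
    have "graph C"
      using indC F.sym_arcs by (intro C.graphI) (rule induced_graph_imp_symmetric)
    then have "path_graph C"
      unfolding path_graph_def using pp Cends vC by (intro conjI exI[of _ p]) auto
    then show ?thesis using vC pp by (simp add: distinct_card)
  qed
  then show ?thesis
    using sub F.graph_axioms by (auto simp: path_factor_def spanning_def)
qed

section \<open>Star-freeness and degrees in terms of the arc relation\<close>

text \<open>Since \<open>I\<close> is independent, \<open>r\<close> neighbours of \<open>w\<close>
  in \<open>I\<close> would induce, together with \<open>w\<close>, a star with centre
  \<open>w\<close>.\<close>

lemma (in graph) star_free_card_neighbours:
  assumes "star_free r G" "I \<subseteq> verts G" "arcs_ends G \<inter> I \<times> I = {}" "0 < r"
  shows "card {x\<in>I. (x, w) \<in> arcs_ends G} < r"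
proof (rule ccontr)
  assume "\<not> ?thesis"
  then obtain L where L: "L \<subseteq> {x\<in>I. (x, w) \<in> arcs_ends G}" "card L = r" "finite L"
    by (meson leI obtain_subset_with_card_n)
  have Lw: "(x, w) \<in> arcs_ends G" "(w, x) \<in> arcs_ends G" "x \<in> I" if "x \<in> L" for x
    using L(1) that sym_arcs unfolding symmetric_def by (auto dest: symD)
  have "L \<noteq> {}" using L(2) \<open>0 < r\<close> by auto
  \<comment> \<open>As \<open>r\<close> is positive there is a leaf, and its arc shows that
    \<open>w\<close> is a vertex of \<open>G\<close>.\<close>
  then obtain x where "(x, w) \<in> arcs_ends G" using Lw by blast
  then have wV: "w \<in> verts G" by (auto simp: arcs_ends_conv)
  have ww: "(w, w) \<notin> arcs_ends G" using no_loops by (auto simp: arcs_ends_conv)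
  then have wL: "w \<notin> L" using Lw by blast
  let ?H = "G \<restriction> (insert w L)"
  have ind: "induced_subgraph ?H G"
    by (rule induced_induce) (use wV L assms(2) in auto)
  interpret H: digraph ?H using ind by (rule digraphI_induced)
  have "graph ?H"
    using ind sym_arcs by (intro H.graphI) (rule induced_graph_imp_symmetric)
  moreover have "verts ?H = {w} \<union> L \<and> {w} \<inter> L = {} \<and> card {w} = 1 \<and> card L = r \<and>
    arcs_ends ?H = {w} \<times> L \<union> L \<times> {w}"
  proof -
    have "arcs_ends ?H = arcs_ends G \<inter> insert w L \<times> insert w L"
      by (rule arcs_ends_induce_subgraph)
    also have "\<dots> = {w} \<times> L \<union> L \<times> {w}" using ww Lw assms(3) by blast
    finally show ?thesis using wL L(2) by simp
  qed
  ultimately have "K\<^bsub>1,r\<^esub> ?H"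
    unfolding complete_bipartite_digraph_def by blast
  then show False using assms(1) ind unfolding star_free_def by blast
qed

text \<open>Without parallel arcs, \<open>head G\<close> is injective on the arcs leaving
  \<open>x\<close>.\<close>

lemma (in graph) out_degree_eq_card_Image: "out_degree G x = card (arcs_ends G `` {x})"
proof -
  have "bij_betw (head G) (out_arcs G x) (arcs_ends G `` {x})"
    using no_multi_arcs
    by (auto simp: bij_betw_def inj_on_def out_arcs_def arcs_ends_conv arc_to_ends_def)
  then show ?thesis unfolding out_degree_def by (rule bij_betw_same_card)
qed

theorem theorem8:
  fixes G :: "('a, 'b) pre_digraph" and r :: nat
  assumes "r \<ge> 3"
    and "graph G"
    and "star_free r G"
    and "min_degree G \<ge> r div 2 + 1"
  shows "path_factor_covered 2 G"
  unfolding path_factor_covered_def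
proof
  fix e assume e: "e \<in> arcs G"
  interpret graph G by (rule assms(2))
  let ?E = "arcs_ends G" and ?u = "tail G e" and ?v = "head G e"
  have EV: "?E \<subseteq> verts G \<times> verts G" by (auto simp: arcs_ends_conv)
  have symE: "sym ?E" using sym_arcs by (simp add: symmetric_def)
  have irrE: "irrefl ?E" using no_loops by (auto simp: irrefl_def arcs_ends_conv)
  have uvE: "(?u, ?v) \<in> ?E" using e by (auto simp: arcs_ends_conv)
  have "card I + 2 \<le> 2 * card (?E `` I)"
    if I: "I \<subseteq> verts G" "I \<noteq> {}" "?E \<inter> I \<times> I = {}" for I
  proof (rule card_neighbours_lower_bound[where m = "r div 2 + 1" and k = "r - 1"])
    show "finite I" using I(1) finite_verts finite_subset by blast
    show "finite (?E `` I)" using finite_subset[OF Image_subset[OF EV]] finite_verts by blast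
    show "\<forall>x\<in>I. r div 2 + 1 \<le> card (?E `` {x})"
    proof
      fix x assume "x \<in> I"
      then have "min_degree G \<le> out_degree G x"
        unfolding min_degree_def using I(1) by (intro Min_le) auto
      then show "r div 2 + 1 \<le> card (?E `` {x})"
        using assms(4) out_degree_eq_card_Image by (metis le_trans)
    qed
    show "\<forall>w. card {x\<in>I. (x, w) \<in> ?E} \<le> r - 1"
    proof
      fix w
      have "card {x\<in>I. (x, w) \<in> ?E} < r"
        by (rule star_free_card_neighbours) (use assms I in auto)
      then show "card {x\<in>I. (x, w) \<in> ?E} \<le> r - 1" by simp
    qed
    \<comment> \<open>Equality for odd \<open>r\<close>, slack one for even \<open>r\<close>: here
      the degree bound is weighed against the size of the forbidden star.\<close>
    show "r - 1 + 2 \<le> 2 * (r div 2 + 1)" using assms(1) by presburger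
  qed (use I in simp)
  then obtain f where f: "\<forall>x\<in>verts G. (x, f x) \<in> ?E"
      "\<forall>y. card {x\<in>verts G. f x = y} \<le> 2" "f ?u = ?v" "f ?v = ?u"
    using exists_functional_graph[OF finite_verts EV symE irrE uvE] by blast
  obtain P p where P: "path_cover ?E (verts G) P" and p: "p \<in> P" "(?u, ?v) \<in> set (vwalk_arcs p)"
    using path_cover_functional_graph[OF finite_verts _ f(1) symE irrE f(2) _ _ f(3,4)]
      f(1) EV e by (metis head_in_verts mem_Sigma_iff subsetD tail_in_verts)
  define R where "R = (\<Union>p\<in>P. set (vwalk_arcs p) \<union> (set (vwalk_arcs p))\<inverse>)"
  let ?F = "G\<lparr>arcs := {e \<in> arcs G. arc_to_ends G e \<in> R}\<rparr>"
  have "path_factor 2 ?F G" using P R_def by (rule path_factor_of_path_cover)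
  moreover have "e \<in> arcs ?F" using e p by (auto simp: R_def arc_to_ends_def)
  ultimately show "\<exists>F. path_factor 2 F G \<and> e \<in> arcs F" by blast
qed

end
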